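(* The universal Burnside kei $\bar Q(4,3)$ (the free commutative kei on $4$ generators) has exactly $81$ elements.
   Context: A kei (also called an involutory quandle) is a set $Q$ with a binary operation $*\colon Q\times Q\to Q$ such that for all $a,b,c\in Q$: (i) $a*a=a$; (ii) $(a*b)*b=a$; (iii) $(a*b)*c=(a*c)*(b*c)$. Omitted parentheses denote left association: $a*b*c=(a*b)*c$. For $n\ge 1$, the universal relation $r_n$ is the identity $a=\dots *a*b*\dots *a*b$, required for all elements $a,b$ of the kei, where the right-hand side is the left-normed product of $n$ letters alternating between $a$ and $b$ and ending in $b$ (for example $r_3$: $a=b*a*b$; $r_4$: $a=a*b*a*b$). The universal Burnside kei $\bar Q(k,n)$ is the free kei on $k$ generators in the class of keis satisfying $r_n$ (the quotient of the free kei on $k$ generators by the relation $r_n$ imposed on all pairs of elements). Relation $r_3$ is equivalent to commutativity $a*b=b*a$, so $\bar Q(k,3)$ is the free commutative kei on $k$ generators. *)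

theory Defs
  imports Main "HOL-Library.FuncSet"
begin

locale kei =
  fixes Q :: "'a set" and star :: "'a \<Rightarrow> 'a \<Rightarrow> 'a" (infixl "\<star>" 70)
  assumes closed: "a \<in> Q \<Longrightarrow> b \<in> Q \<Longrightarrow> a \<star> b \<in> Q"
    and idem: "a \<in> Q \<Longrightarrow> a \<star> a = a"
    and invol: "a \<in> Q \<Longrightarrow> b \<in> Q \<Longrightarrow> (a \<star> b) \<star> b = a"
    and distrib: "a \<in> Q \<Longrightarrow> b \<in> Q \<Longrightarrow> c \<in> Q \<Longrightarrow> (a \<star> b) \<star> c = (a \<star> c) \<star> (b \<star> c)"

text \<open>
  \<open>alt_prod f n a b\<close> is the left-normed product of \<open>n\<close> letters alternating between \<open>a\<close> and \<open>b\<close>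
  and ending in \<open>b\<close>; its first \<open>n - 1\<close> letters alternate and end in \<open>a\<close>, whence the swap in the
  recursion.  Only \<open>n \<ge> 1\<close> is meaningful; the value at \<open>0\<close> is chosen so that the relation below
  is void there.
\<close>

fun alt_prod :: "('a \<Rightarrow> 'a \<Rightarrow> 'a) \<Rightarrow> nat \<Rightarrow> 'a \<Rightarrow> 'a \<Rightarrow> 'a" where
  "alt_prod f 0 a b = a"
| "alt_prod f (Suc 0) a b = b"
| "alt_prod f (Suc (Suc n)) a b = f (alt_prod f (Suc n) b a) b"

lemma alt_prod_3: "alt_prod f 3 a b = f (f b a) b"
  by (simp add: numeral_eq_Suc)

lemma alt_prod_4: "alt_prod f 4 a b = f (f (f a b) a) b"
  by (simp add: numeral_eq_Suc)

definition satisfies_r :: "nat \<Rightarrow> 'a set \<Rightarrow> ('a \<Rightarrow> 'a \<Rightarrow> 'a) \<Rightarrow> bool" where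
  "satisfies_r n Q f \<longleftrightarrow> (\<forall>a\<in>Q. \<forall>b\<in>Q. a = alt_prod f n a b)"

datatype kterm = Gen nat | Op kterm kterm

inductive_set kterms :: "nat \<Rightarrow> kterm set" for k :: nat where
  gen: "i < k \<Longrightarrow> Gen i \<in> kterms k"
| op: "s \<in> kterms k \<Longrightarrow> t \<in> kterms k \<Longrightarrow> Op s t \<in> kterms k"

text \<open>
  The least congruence on the terms in \<open>k\<close> generators that makes the quotient a kei satisfying
  \<open>r_n\<close>.
\<close>

inductive burnside_cong :: "nat \<Rightarrow> nat \<Rightarrow> kterm \<Rightarrow> kterm \<Rightarrow> bool" for k n :: nat where
  refl: "a \<in> kterms k \<Longrightarrow> burnside_cong k n a a"
| sym: "burnside_cong k n a b \<Longrightarrow> burnside_cong k n b a"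
| trans: "burnside_cong k n a b \<Longrightarrow> burnside_cong k n b c \<Longrightarrow> burnside_cong k n a c"
| op: "burnside_cong k n a a' \<Longrightarrow> burnside_cong k n b b' \<Longrightarrow>
    burnside_cong k n (Op a b) (Op a' b')"
| idem: "a \<in> kterms k \<Longrightarrow> burnside_cong k n (Op a a) a"
| invol: "a \<in> kterms k \<Longrightarrow> b \<in> kterms k \<Longrightarrow> burnside_cong k n (Op (Op a b) b) a"
| distrib: "a \<in> kterms k \<Longrightarrow> b \<in> kterms k \<Longrightarrow> c \<in> kterms k \<Longrightarrow>
    burnside_cong k n (Op (Op a b) c) (Op (Op a c) (Op b c))"
| rel: "a \<in> kterms k \<Longrightarrow> b \<in> kterms k \<Longrightarrow> burnside_cong k n a (alt_prod Op n a b)"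

definition burnside_rel :: "nat \<Rightarrow> nat \<Rightarrow> (kterm \<times> kterm) set" where
  "burnside_rel k n = {(s, t). burnside_cong k n s t}"

definition burnside_kei :: "nat \<Rightarrow> nat \<Rightarrow> kterm set set" where
  "burnside_kei k n = kterms k // burnside_rel k n"

definition burnside_class :: "nat \<Rightarrow> nat \<Rightarrow> kterm \<Rightarrow> kterm set" where
  "burnside_class k n s = burnside_rel k n `` {s}"

definition burnside_op :: "nat \<Rightarrow> nat \<Rightarrow> kterm set \<Rightarrow> kterm set \<Rightarrow> kterm set" where
  "burnside_op k n A B = (\<Union>a\<in>A. \<Union>b\<in>B. burnside_class k n (Op a b))"

definition burnside_gen :: "nat \<Rightarrow> nat \<Rightarrow> nat \<Rightarrow> kterm set" where
  "burnside_gen k n i = burnside_class k n (Gen i)"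

text \<open>
  The rest shows that this is the free kei on \<open>k\<close> generators among the keis satisfying \<open>r_n\<close>:
  it is such a kei, and it has the universal property.
\<close>

lemma alt_prod_closed:
  assumes "\<And>a b. a \<in> Q \<Longrightarrow> b \<in> Q \<Longrightarrow> f a b \<in> Q" "a \<in> Q" "b \<in> Q"
  shows "alt_prod f n a b \<in> Q"
  using assms by (induction f n a b rule: alt_prod.induct) auto

lemma alt_prod_hom:
  assumes "\<And>a b. a \<in> Q \<Longrightarrow> b \<in> Q \<Longrightarrow> h (f a b) = g (h a) (h b)"
    and "\<And>a b. a \<in> Q \<Longrightarrow> b \<in> Q \<Longrightarrow> f a b \<in> Q" "a \<in> Q" "b \<in> Q"
  shows "h (alt_prod f n a b) = alt_prod g n (h a) (h b)"
  using assms by (induction f n a b rule: alt_prod.induct) (auto simp: alt_prod_closed)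

lemma burnside_cong_kterms:
  "burnside_cong k n s t \<Longrightarrow> s \<in> kterms k \<and> t \<in> kterms k"
  by (induction rule: burnside_cong.induct) (auto intro: kterms.intros alt_prod_closed)

lemma equiv_burnside_rel: "equiv (kterms k) (burnside_rel k n)"
proof (rule equivI)
  show "burnside_rel k n \<subseteq> kterms k \<times> kterms k"
    by (auto simp: burnside_rel_def dest: burnside_cong_kterms)
  show "refl_on (kterms k) (burnside_rel k n)"
    by (auto simp: burnside_rel_def refl_on_def intro: burnside_cong.refl)
  show "sym_on UNIV (burnside_rel k n)"
    by (rule symI) (simp add: burnside_rel_def burnside_cong.sym)
  show "trans_on UNIV (burnside_rel k n)"
    by (rule transI) (simp add: burnside_rel_def, rule burnside_cong.trans)
qed

lemma burnside_class_eq_iff: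
  assumes "s \<in> kterms k" "t \<in> kterms k"
  shows "burnside_class k n s = burnside_class k n t \<longleftrightarrow> burnside_cong k n s t"
  using eq_equiv_class_iff[OF equiv_burnside_rel assms]
  by (simp add: burnside_rel_def burnside_class_def)

lemma burnside_op_class:
  assumes "s \<in> kterms k" "t \<in> kterms k"
  shows "burnside_op k n (burnside_class k n s) (burnside_class k n t)
    = burnside_class k n (Op s t)"
proof -
  have mem: "u \<in> burnside_class k n v \<longleftrightarrow> burnside_cong k n v u" for u v
    by (simp add: burnside_class_def burnside_rel_def)
  have "burnside_class k n (Op a b) = burnside_class k n (Op s t)"
    if "a \<in> burnside_class k n s" "b \<in> burnside_class k n t" for a b
  proof -
    have ab: "burnside_cong k n s a" "burnside_cong k n t b"
      using that by (simp_all add: mem)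
    then have "a \<in> kterms k" "b \<in> kterms k"
      by (blast dest: burnside_cong_kterms)+
    moreover have "burnside_cong k n (Op a b) (Op s t)"
      using ab by (blast intro: burnside_cong.op burnside_cong.sym)
    ultimately show ?thesis
      using assms by (simp add: burnside_class_eq_iff kterms.op)
  qed
  moreover have "s \<in> burnside_class k n s" "t \<in> burnside_class k n t"
    using assms by (simp_all add: mem burnside_cong.refl)
  ultimately show ?thesis
    unfolding burnside_op_def by blast
qed

lemma burnside_kei_cases:
  assumes "A \<in> burnside_kei k n"
  obtains s where "s \<in> kterms k" "A = burnside_class k n s"
  using assms unfolding burnside_kei_def burnside_class_def by (auto elim: quotientE)

lemma burnside_class_in: "s \<in> kterms k \<Longrightarrow> burnside_class k n s \<in> burnside_kei k n"
  unfolding burnside_kei_def burnside_class_def by (rule quotientI)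

lemma burnside_kei_kei: "kei (burnside_kei k n) (burnside_op k n)"
  by unfold_locales
    (elim burnside_kei_cases,
      simp add: burnside_op_class burnside_class_in kterms.op burnside_class_eq_iff
        burnside_cong.idem burnside_cong.invol burnside_cong.distrib)+

lemma burnside_kei_satisfies_r: "satisfies_r n (burnside_kei k n) (burnside_op k n)"
  unfolding satisfies_r_def
proof (intro ballI)
  fix A B assume "A \<in> burnside_kei k n" "B \<in> burnside_kei k n"
  then obtain a b where ab: "a \<in> kterms k" "b \<in> kterms k"
    "A = burnside_class k n a" "B = burnside_class k n b"
    by (metis burnside_kei_cases)
  have "burnside_class k n (alt_prod Op n a b) = alt_prod (burnside_op k n) n A B"
    unfolding ab(3,4)
    by (rule alt_prod_hom[where h = "\<lambda>s. burnside_class k n s" and Q = "kterms k"])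
      (auto simp: burnside_op_class ab intro: kterms.op)
  moreover have "burnside_class k n (alt_prod Op n a b) = A"
    using ab by (simp add: burnside_class_eq_iff alt_prod_closed kterms.op
        burnside_cong.sym burnside_cong.rel)
  ultimately show "A = alt_prod (burnside_op k n) n A B" by simp
qed

lemma burnside_gen_in: "i < k \<Longrightarrow> burnside_gen k n i \<in> burnside_kei k n"
  by (simp add: burnside_gen_def burnside_class_in kterms.gen)

primrec kterm_eval :: "('a \<Rightarrow> 'a \<Rightarrow> 'a) \<Rightarrow> (nat \<Rightarrow> 'a) \<Rightarrow> kterm \<Rightarrow> 'a" where
  "kterm_eval f g (Gen i) = g i"
| "kterm_eval f g (Op s t) = f (kterm_eval f g s) (kterm_eval f g t)"

lemma kterm_eval_in:
  assumes "kei Q f" "\<And>i. i < k \<Longrightarrow> g i \<in> Q" "s \<in> kterms k"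
  shows "kterm_eval f g s \<in> Q"
  using assms(3) by induction (auto simp: assms(2) kei.closed[OF assms(1)])

lemma kterm_eval_cong:
  assumes Q: "kei Q f" and r: "satisfies_r n Q f" and g: "\<And>i. i < k \<Longrightarrow> g i \<in> Q"
    and st: "burnside_cong k n s t"
  shows "kterm_eval f g s = kterm_eval f g t"
proof -
  have ev: "kterm_eval f g u \<in> Q" if "u \<in> kterms k" for u
    using Q g that by (rule kterm_eval_in)
  show ?thesis
    using st
  proof induction
    case (rel a b)
    have "kterm_eval f g (alt_prod Op n a b)
        = alt_prod f n (kterm_eval f g a) (kterm_eval f g b)"
      by (rule alt_prod_hom[where Q = UNIV]) auto
    moreover have "kterm_eval f g a = alt_prod f n (kterm_eval f g a) (kterm_eval f g b)"
      using r ev[OF rel(1)] ev[OF rel(2)] unfolding satisfies_r_def by blast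
    ultimately show ?case by metis
  next
    case (distrib a b c)
    then show ?case
      by (simp only: kterm_eval.simps) (intro kei.distrib[OF Q] ev)
  next
    case (invol a b)
    then show ?case
      by (simp only: kterm_eval.simps) (intro kei.invol[OF Q] ev)
  next
    case (idem a)
    then show ?case
      by (simp only: kterm_eval.simps) (intro kei.idem[OF Q] ev)
  qed simp_all
qed

theorem burnside_kei_universal:
  fixes g :: "nat \<Rightarrow> 'a"
  assumes Q: "kei Q f" and r: "satisfies_r n Q f" and g: "\<And>i. i < k \<Longrightarrow> g i \<in> Q"
  shows "\<exists>!h. h \<in> burnside_kei k n \<rightarrow>\<^sub>E Q
    \<and> (\<forall>A\<in>burnside_kei k n. \<forall>B\<in>burnside_kei k n. h (burnside_op k n A B) = f (h A) (h B))
    \<and> (\<forall>i<k. h (burnside_gen k n i) = g i)" (is "\<exists>!h. ?P h")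
proof (rule ex_ex1I)
  define h where "h = restrict (\<lambda>A. kterm_eval f g (SOME s. s \<in> A)) (burnside_kei k n)"
  have h: "h (burnside_class k n s) = kterm_eval f g s" if s: "s \<in> kterms k" for s
  proof -
    have "s \<in> burnside_class k n s"
      using s by (auto simp: burnside_class_def burnside_rel_def intro: burnside_cong.refl)
    then have "(SOME t. t \<in> burnside_class k n s) \<in> burnside_class k n s"
      by (rule someI)
    then have "burnside_cong k n s (SOME t. t \<in> burnside_class k n s)"
      by (simp add: burnside_class_def burnside_rel_def)
    from kterm_eval_cong[OF Q r g this] show ?thesis
      using s by (simp add: h_def burnside_class_in)
  qed
  show "\<exists>h. ?P h"
  proof (rule exI[of _ h], intro conjI ballI allI impI)
    show "h \<in> burnside_kei k n \<rightarrow>\<^sub>E Q"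
    proof (rule PiE_I)
      fix A assume "A \<in> burnside_kei k n"
      then show "h A \<in> Q"
        by (auto elim!: burnside_kei_cases simp: h kterm_eval_in[OF Q g])
    qed (simp add: h_def)
  next
    fix A B assume "A \<in> burnside_kei k n" "B \<in> burnside_kei k n"
    then show "h (burnside_op k n A B) = f (h A) (h B)"
      by (auto elim!: burnside_kei_cases simp: h burnside_op_class kterms.op)
  next
    fix i assume "i < k"
    then show "h (burnside_gen k n i) = g i"
      by (simp add: burnside_gen_def h kterms.gen)
  qed
next
  fix h h' assume P: "?P h" "?P h'"
  have *: "h (burnside_class k n s) = h' (burnside_class k n s)"
    if "s \<in> kterms k" for s
    using that
  proof induction
    case (gen i)
    with P show ?case by (simp flip: burnside_gen_def)
  next
    case (op s t)
    with P show ?case by (simp add: burnside_class_in flip: burnside_op_class)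
  qed
  show "h = h'"
  proof (rule PiE_ext)
    show "h \<in> burnside_kei k n \<rightarrow>\<^sub>E Q" "h' \<in> burnside_kei k n \<rightarrow>\<^sub>E Q" using P by blast+
    show "h A = h' A" if "A \<in> burnside_kei k n" for A
      using that by (auto elim!: burnside_kei_cases simp: *)
  qed
qed

end

theory Submission
  imports Defs "HOL-Library.Numeral_Type"
begin

text \<open>
  By \<open>r_3\<close> the free object is a commutative kei.  In such a kei, read \<open>a \<star> b\<close> as the third point on the
  line through \<open>a\<close> and \<open>b\<close>; the model to keep in mind is \<open>a \<star> b = - a - b\<close> on a vector space over
  the field with three elements.  Write \<open>R\<^sub>a\<close> for \<open>x \<mapsto> x \<star> a\<close>, and products of such maps from left to
  right.  These maps are involutive automorphisms, and commutativity says that any two of them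
  satisfy the braid relation, as \<open>R\<^sub>a\<^sub>\<star>\<^sub>b\<close> is both \<open>R\<^sub>b R\<^sub>a R\<^sub>b\<close> and \<open>R\<^sub>a R\<^sub>b R\<^sub>a\<close>.

  In a vector space \<open>R\<^sub>a R\<^sub>b R\<^sub>c\<close> is the reflection in \<open>a - b + c\<close>, hence an involution.  In general its
  square, the holonomy \<open>hol a b c\<close>, need not be the identity; but it is an automorphism that fixes
  \<open>a\<close>, \<open>b\<close>, \<open>c\<close> and satisfies \<open>(hol a b c)\<^sup>3 = id\<close>.  So everything generated by three points is affine,
  and with four generators \<open>a\<close>, \<open>b\<close>, \<open>c\<close>, \<open>e\<close> the deviation is measured by the displacement of \<open>c\<close> under
  \<open>hol a e b\<close>.  Two facts control it.  First, a point and its images under a holonomy and under the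
  inverse holonomy are collinear (\<open>hol_collinear\<close>).  Secondly, the displaced point
  \<open>hol a e b c\<close> is fixed by \<open>hol a e c\<close> (\<open>hol_fixes_hol\<close>).  In terms of the commutative Moufang loop
  with unit \<open>e\<close>, they make the associator of the three other generators alternating and central.

  Hence the translation \<open>shift\<close> that takes \<open>c\<close> to \<open>hol a e b c\<close> satisfies \<open>shift (x \<star> y) = shift\<inverse> x \<star> y\<close>
  (\<open>shift_times\<close>): its orbits, of at most three points, form a congruence.  The holonomies of the
  generators act trivially on the quotient, where therefore the three translations \<open>R\<^sub>e R\<^sub>g\<close> of
  order 3 commute (\<open>near_swap\<close>) and reach everything from \<open>e\<close>.  The quotient has at most 27 elements and
  the kei at most 81 (\<open>card_le_81\<close>).

  The bound is attained: adding a suitable cubic term to \<open>- a - b\<close> in the last coordinate gives a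
  commutative kei on the fourth power of the field with three elements, generated by four of its
  points (\<open>hall_kei\<close>, \<open>hall_generated\<close>).
\<close>

section \<open>Commutative keis\<close>

locale commutative_kei = kei UNIV star for star :: "'a \<Rightarrow> 'a \<Rightarrow> 'a" (infixl "\<star>" 70) +
  assumes comm: "a \<star> b = b \<star> a"
begin

lemma self [simp]: "a \<star> a = a"
  by (rule idem) simp

lemma cancel [simp]: "a \<star> b \<star> b = a"
  by (rule invol) simp_all

lemma cancel_left [simp]: "b \<star> (b \<star> a) = a" "b \<star> (a \<star> b) = a"
  using cancel comm by metis+

lemma right_distrib: "(a \<star> b) \<star> c = (a \<star> c) \<star> (b \<star> c)"
  by (rule distrib) simp_all

text \<open>
  Conjugating \<open>R\<^sub>y\<close> by the automorphism \<open>R\<^sub>z\<close> gives the map belonging to the image of \<open>y\<close>.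
\<close>

lemma star_star: "x \<star> (y \<star> z) = x \<star> z \<star> y \<star> z"
  using right_distrib[of "x \<star> z" y z] by simp

lemma braid: "x \<star> y \<star> z \<star> y = x \<star> z \<star> y \<star> z"
  using star_star[of x y z] star_star[of x z y] comm[of y z] by simp

section \<open>Holonomy of three points\<close>

text \<open>
  The square of \<open>R\<^sub>a R\<^sub>b R\<^sub>c\<close>.  Its triviality for all triples is the medial law, which characterises
  the affine case.
\<close>

definition hol :: "'a \<Rightarrow> 'a \<Rightarrow> 'a \<Rightarrow> 'a \<Rightarrow> 'a" where
  "hol a b c x = x \<star> a \<star> b \<star> c \<star> a \<star> b \<star> c"

lemma hol_star: "hol a b c (x \<star> y) = hol a b c x \<star> hol a b c y"
  unfolding hol_def by (simp only: right_distrib[symmetric])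

lemma hol_inverse [simp]: "hol c b a (hol a b c x) = x"
  by (simp add: hol_def)

lemma hol_fixes [simp]: "hol a b c a = a" "hol a b c b = b" "hol a b c c = c"
proof -
  have first: "hol a b c a = a" for a b c
  proof -
    have "a \<star> b \<star> c \<star> a = c \<star> a \<star> b"
      using right_distrib[of "a \<star> b" c a] by (simp add: comm)
    then show ?thesis
      by (simp add: hol_def comm[of c a])
  qed
  then show "hol a b c a = a" .
  show "hol a b c b = b"
    by (simp add: hol_def comm[of b a] comm[of a c] comm[of c b])
  show "hol a b c c = c"
    by (metis first hol_inverse)
qed

lemma hol_star_fixed [simp]:
  "hol a b c (x \<star> a) = hol a b c x \<star> a"
  "hol a b c (x \<star> b) = hol a b c x \<star> b"
  "hol a b c (x \<star> c) = hol a b c x \<star> c"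
  by (simp_all add: hol_star)

text \<open>
  Both sides differ by conjugation with \<open>R\<^sub>a\<close>, which commutes with a holonomy that fixes \<open>a\<close>.
\<close>

lemma hol_rotate: "hol b c a x = hol a b c x"
proof -
  have "hol b c a x = hol a b c (x \<star> a) \<star> a"
    by (simp add: hol_def)
  then show ?thesis by simp
qed

text \<open>
  In the affine model \<open>a \<star> c \<star> b\<close> is \<open>a - b + c\<close>, and \<open>R\<^sub>a R\<^sub>b R\<^sub>c\<close> itself is the reflection in
  that point; in general this holds only for its cube.  The relation that is used, apart from the braid
  relations of the letters, is the one between \<open>a\<close> and \<open>b \<star> c\<close>.
\<close>

lemma word_cubed: "x \<star> a \<star> b \<star> c \<star> a \<star> b \<star> c \<star> a \<star> b \<star> c = x \<star> (a \<star> c \<star> b)"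
proof -
  define q where "q = b \<star> c"
  have q: "y \<star> q = y \<star> c \<star> b \<star> c" for y
    by (simp add: q_def star_star)
  have q': "y \<star> q = y \<star> b \<star> c \<star> b" for y
    by (simp add: q braid)
  have "x \<star> a \<star> b \<star> c \<star> a \<star> b \<star> c \<star> a \<star> b \<star> c
      = x \<star> a \<star> q \<star> b \<star> a \<star> b \<star> c \<star> a \<star> b \<star> c"
    by (simp add: q')
  also have "\<dots> = x \<star> a \<star> q \<star> a \<star> b \<star> a \<star> c \<star> a \<star> b \<star> c"
    by (simp only: braid[of _ a b])
  also have "\<dots> = x \<star> a \<star> q \<star> a \<star> b \<star> c \<star> a \<star> q"
    by (simp only: braid[of _ c a] q)
  also have "\<dots> = x \<star> a \<star> q \<star> a \<star> q \<star> b \<star> a \<star> q"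
    by (simp add: q')
  also have "\<dots> = x \<star> q \<star> a \<star> b \<star> a \<star> q"
    by (simp add: braid[of _ a q])
  also have "\<dots> = x \<star> b \<star> c \<star> a \<star> c \<star> b"
    by (simp add: braid[of _ a b]) (simp add: q')
  also have "\<dots> = x \<star> (a \<star> c \<star> b)"
    by (simp add: star_star[of _ _ b] star_star[of _ a c] braid[of _ a c])
  finally show ?thesis .
qed

lemma hol_cubed: "hol a b c (hol a b c (hol a b c x)) = x"
  by (simp add: hol_def word_cubed)

lemma hol_twice: "hol a b c (hol a b c x) = hol c b a x"
  by (metis hol_cubed hol_inverse)

lemma word_eq_hol: "x \<star> a \<star> b \<star> c = hol c b a x \<star> (a \<star> c \<star> b)"
proof -
  have "hol a b c (x \<star> a \<star> b \<star> c) = x \<star> (a \<star> c \<star> b)"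
    by (simp only: hol_def word_cubed)
  then have "x \<star> a \<star> b \<star> c = hol c b a (x \<star> (a \<star> c \<star> b))"
    by (metis hol_inverse)
  then show ?thesis by (simp add: hol_star)
qed

text \<open>
  In the affine picture \<open>w\<close>, \<open>r\<close>, \<open>s\<close> are equally spaced on the parallel through \<open>r\<close> to the line \<open>p q\<close>,
  namely \<open>w = r - (p - q)\<close> and \<open>s = r + (p - q)\<close>.  The inverse holonomy of \<open>p\<close>, \<open>q\<close>, \<open>r\<close> is
  \<open>R\<^sub>p R\<^sub>q R\<^sub>r R\<^sub>s\<close>.  In \<open>c \<star> p \<star> q \<star> r \<star> s\<close> the first two letters can be exchanged, and then \<open>R\<^sub>c\<close>
  can be moved to the right through the others.  This reverses the segment \<open>p q\<close> and so turns the word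
  into the holonomy itself, with an error that is the holonomy of \<open>w\<close>, \<open>r\<close>, \<open>c\<close>.
\<close>

lemma hol_collinear_up_to_hol:
  fixes p q r c
  defines "w \<equiv> q \<star> r \<star> p"
  shows "hol r q p c = hol w r c (hol p q r c \<star> c)"
proof -
  define s where "s = p \<star> r \<star> q"
  have "w \<star> r = q \<star> p \<star> r \<star> p"
    by (simp add: w_def braid)
  also have "\<dots> = s"
    using right_distrib[of "p \<star> q" r p] by (simp add: s_def comm)
  finally have ws: "w \<star> r = s" .
  have s: "y \<star> s = y \<star> r \<star> w \<star> r" for y
    unfolding ws[symmetric] by (simp add: star_star)
  have K: "hol r q p c = c \<star> p \<star> q \<star> r \<star> s"
    by (simp add: word_eq_hol s_def)
  \<comment> \<open>The form of the braid relation that moves \<open>R\<^sub>c\<close> to the right.\<close>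
  have slide: "y \<star> c \<star> x = y \<star> x \<star> c \<star> x \<star> c" for x y
    by (simp add: braid[of _ x c])
  have "c \<star> p \<star> q \<star> r \<star> s \<star> c = p \<star> c \<star> q \<star> r \<star> s \<star> c"
    by (simp add: comm[of c p])
  also have "\<dots> = p \<star> q \<star> c \<star> q \<star> r \<star> c \<star> r \<star> s \<star> c \<star> s"
    by (simp add: slide[of p q] slide[of "p \<star> q \<star> c \<star> q" r]
        slide[of "p \<star> q \<star> c \<star> q \<star> r \<star> c \<star> r" s])
  also have "\<dots> = c \<star> q \<star> p \<star> r \<star> c \<star> r \<star> s \<star> c \<star> s"
    using star_star[of c p q] by (simp add: comm[of "p \<star> q" c])
  also have "\<dots> = hol p q r c \<star> w \<star> c \<star> r \<star> s \<star> c \<star> s"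
    by (simp add: word_eq_hol[of c q p r] w_def hol_rotate[of p q r])
  also have "\<dots> = hol p q r c \<star> w \<star> c \<star> w \<star> r \<star> c \<star> r \<star> w \<star> r"
    by (simp add: s)
  also have "\<dots> = hol w r c (hol p q r c \<star> c) \<star> c"
    by (simp add: hol_def braid[of _ w c] braid[of _ r c])
  finally show ?thesis
    unfolding K by (metis cancel)
qed

text \<open>
  The error in the preceding lemma vanishes: it depends on the orientation of the segment \<open>w r\<close>, whereas
  the rest does not.  Indeed \<open>p \<star> r\<close>, \<open>q \<star> r\<close>, \<open>w\<close> is a triple with the same product of reflections as
  \<open>p\<close>, \<open>q\<close>, \<open>r\<close>, and for it \<open>w\<close> and \<open>r\<close> change places.  So the holonomy of \<open>w\<close>, \<open>r\<close>, \<open>c\<close> agrees with its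
  own inverse at the point \<open>y\<close>, and since its cube is the identity it fixes \<open>y\<close>.
\<close>

lemma hol_collinear: "c \<star> hol p q r c = hol r q p c"
proof -
  define w where "w = q \<star> r \<star> p"
  define y where "y = hol p q r c \<star> c"
  have word: "x \<star> (p \<star> r) \<star> (q \<star> r) \<star> w = x \<star> p \<star> q \<star> r" for x
  proof -
    define u where "u = q \<star> p"
    have u: "y \<star> u = y \<star> p \<star> q \<star> p" for y
      by (simp add: u_def star_star)
    have "x \<star> (p \<star> r) \<star> (q \<star> r) \<star> w = x \<star> r \<star> p \<star> q \<star> r \<star> p \<star> r \<star> q \<star> r \<star> p"
      by (simp add: w_def star_star)
    also have "\<dots> = x \<star> r \<star> u \<star> r \<star> u \<star> p \<star> r \<star> p"
      by (simp add: u braid[of _ r p])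
    also have "\<dots> = x \<star> u \<star> r \<star> r \<star> p \<star> r"
      by (simp add: braid[of _ r u] braid[of _ p r])
    also have "\<dots> = x \<star> p \<star> q \<star> r"
      by (simp add: u)
    finally show ?thesis .
  qed
  have "hol (p \<star> r) (q \<star> r) w x = hol p q r x" for x
    by (simp only: hol_def word)
  moreover have "hol w (q \<star> r) (p \<star> r) x = hol r q p x" for x
    using calculation by (metis hol_inverse)
  moreover have "q \<star> r \<star> w \<star> (p \<star> r) = r"
    by (simp add: w_def)
  ultimately have "hol r q p c = hol r w c y"
    using hol_collinear_up_to_hol[where p = "p \<star> r" and q = "q \<star> r" and r = w and c = c] by (simp add: y_def)
  moreover have "hol r q p c = hol w r c y"
    unfolding y_def w_def by (rule hol_collinear_up_to_hol)
  ultimately have "hol w r c y = hol c r w y"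
    by (metis hol_rotate)
  then have "hol w r c y = y"
    by (metis hol_twice hol_inverse)
  then show ?thesis
    using \<open>hol r q p c = hol w r c y\<close> by (simp add: y_def comm)
qed

text \<open>
  The holonomies of \<open>a\<close>, \<open>e\<close>, \<open>c\<close> and of \<open>a\<close>, \<open>e\<close>, \<open>b\<close> are inverse to each other at \<open>y = b \<star> a \<star> e \<star> c\<close>.  The
  reason is that the point \<open>z = b \<star> c \<star> e \<star> a = c \<star> b \<star> e \<star> a\<close> can be reached by a three-letter word
  from \<open>b\<close> and from \<open>c\<close>: the first makes it the image of \<open>y\<close> under the inverse of the former holonomy,
  the second the image under the latter.
\<close>

lemma hol_exchange: "hol a e c (b \<star> a \<star> e \<star> c) = hol b e a c \<star> (b \<star> a \<star> e)"
proof -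
  define d where "d = b \<star> a \<star> e"
  define y where "y = b \<star> a \<star> e \<star> c"
  define z where "z = b \<star> c \<star> e \<star> a"
  have d_fixed: "hol a e b d = d" "hol b e a d = d"
    by (simp_all add: d_def comm[of b a])
  have y: "y = d \<star> c"
    by (simp add: y_def d_def)
  have "z = hol c e a y"
    by (simp add: y_def z_def hol_def)
  moreover have "z = hol a e b y"
    using word_eq_hol[of c b e a] by (simp add: z_def y hol_star d_fixed comm[of b c] comm[of d]
        flip: d_def)
  ultimately have "hol a e c y = hol b e a y"
    using hol_collinear[of y] by metis
  then show ?thesis
    by (simp add: y hol_star d_fixed comm[of d] flip: d_def y_def)
qed

text \<open>
  Being an automorphism, \<open>hol a e c\<close> is determined at \<open>h\<close> by its values at \<open>d\<close> and at \<open>h \<star> d\<close>.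
  As \<open>h \<star> d\<close> is \<open>b \<star> c \<star> e \<star> a\<close>, the latter can be read off from the definition; the former is known from
  the exchange of holonomies, because \<open>d\<close> lies on a line with the fixed point \<open>c\<close> and
  \<open>b \<star> a \<star> e \<star> c\<close>.
\<close>

lemma hol_fixes_hol: "hol a e c (hol a e b c) = hol a e b c"
proof -
  define d where "d = b \<star> a \<star> e"
  define h where "h = hol a e b c"
  define h' where "h' = hol b e a c"
  have h': "h' = h \<star> c"
    using hol_collinear[of c a e b] by (simp add: h_def h'_def comm)
  have "h \<star> d = b \<star> c \<star> e \<star> a"
    using word_eq_hol[of c b e a] by (simp add: h_def d_def comm[of b c])
  then have "hol a e c (h \<star> d) = d \<star> c"
    by (simp add: d_def hol_def)
  moreover have "hol a e c d \<star> c = h' \<star> d"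
    using hol_exchange[of a e c b] by (simp add: h'_def flip: d_def)
  then have "hol a e c d = h' \<star> d \<star> c"
    by (metis cancel)
  ultimately have "hol a e c h \<star> (h' \<star> d \<star> c) = d \<star> c"
    by (simp add: hol_star)
  then have "hol a e c h = d \<star> c \<star> (h' \<star> d \<star> c)"
    by (metis cancel)
  also have "\<dots> = d \<star> (h' \<star> d) \<star> c"
    by (rule right_distrib[symmetric])
  also have "\<dots> = h"
    by (simp add: h')
  finally show ?thesis by (simp add: h_def)
qed

end

section \<open>Four generators: a central translation\<close>

text \<open>
  Generation is expressed as the induction principle that it gives.
\<close>

locale four_generated_commutative_kei = commutative_kei +
  fixes a b c e :: 'a
  assumes generated: "\<And>P x. P a \<Longrightarrow> P b \<Longrightarrow> P c \<Longrightarrow> P e \<Longrightarrow>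
    (\<And>x y. P x \<Longrightarrow> P y \<Longrightarrow> P (x \<star> y)) \<Longrightarrow> P x"
begin

definition shifted :: 'a where "shifted = hol a e b c"

text \<open>
  In the affine picture, the translation from \<open>c\<close> to \<open>shifted\<close>.
\<close>

definition shift :: "'a \<Rightarrow> 'a" where "shift x = x \<star> shifted \<star> c"

definition unshift :: "'a \<Rightarrow> 'a" where "unshift x = x \<star> c \<star> shifted"

lemma shift_unshift [simp]: "shift (unshift x) = x" "unshift (shift x) = x"
  by (simp_all add: shift_def unshift_def)

lemma shift_shift [simp]: "shift (shift x) = unshift x" "unshift (unshift x) = shift x"
  by (simp_all add: shift_def unshift_def braid)

lemma endomorphisms_eqI:
  assumes "\<And>x y. f (x \<star> y) = f x \<star> f y" "\<And>x y. g (x \<star> y) = g x \<star> g y"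
    and "f a = g a" "f b = g b" "f c = g c" "f e = g e"
  shows "f x = g x"
  using generated[of "\<lambda>x. f x = g x" x] assms by simp

lemma shift_star: "shift (x \<star> y) = shift x \<star> shift y"
  and unshift_star: "unshift (x \<star> y) = unshift x \<star> unshift y"
  by (simp_all only: shift_def unshift_def right_distrib[symmetric])

text \<open>
  Both sides are automorphisms, so they need to be compared only at the generators \<open>p\<close>.  There the
  equation amounts to \<open>shifted\<close> being fixed by \<open>hol g p c\<close>.
\<close>

lemma shift_times_generator_aux:
  assumes "\<And>p. p \<in> {a, b, c, e} \<Longrightarrow> hol g p c shifted = shifted"
  shows "shift (x \<star> g) \<star> g = unshift x"
proof -
  have "shift (p \<star> g) \<star> g = unshift p" if "p \<in> {a, b, c, e}" for p
  proof -
    have "shift (p \<star> g) \<star> g = shifted \<star> g \<star> p \<star> c \<star> g \<star> c"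
      by (simp add: shift_def comm[of "p \<star> g" shifted] star_star braid[of _ g c])
    also have "shifted \<star> g \<star> p \<star> c \<star> g \<star> c = hol g p c shifted \<star> c \<star> p \<star> c"
      by (simp add: hol_def)
    also have "\<dots> = unshift p"
      by (simp add: assms[OF that] unshift_def comm[of "p \<star> c"] star_star)
    finally show ?thesis .
  qed
  moreover have "shift (x \<star> y \<star> g) \<star> g = (shift (x \<star> g) \<star> g) \<star> (shift (y \<star> g) \<star> g)" for x y
    by (simp only: shift_star right_distrib[symmetric])
  ultimately show ?thesis
    using endomorphisms_eqI[of "\<lambda>x. shift (x \<star> g) \<star> g" unshift x] by (simp add: unshift_star)
qed

lemma hol_fixes_shifted:
  "hol a e c shifted = shifted" "hol e b c shifted = shifted" "hol b a c shifted = shifted"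
  "hol e a c shifted = shifted" "hol b e c shifted = shifted" "hol a b c shifted = shifted"
proof -
  show *: "hol a e c shifted = shifted" "hol e b c shifted = shifted" "hol b a c shifted = shifted"
    using hol_fixes_hol[of a e c b] hol_fixes_hol[of e b c a] hol_fixes_hol[of b a c e]
    by (simp_all only: shifted_def hol_rotate[where a = a and b = e and c = b]
        hol_rotate[where a = e and b = b and c = a])
  have inverse: "hol y x c shifted = shifted" if "hol x y c shifted = shifted" for x y
    using that hol_inverse[of c y x shifted] by (simp only: hol_rotate[of y x c])
  show "hol e a c shifted = shifted" "hol b e c shifted = shifted" "hol a b c shifted = shifted"
    by (rule inverse, rule *)+
qed

lemma shift_times_generator:
  assumes "g \<in> {a, b, c, e}"
  shows "shift (x \<star> g) = unshift x \<star> g"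
proof -
  have "hol g p c shifted = shifted" if "g \<noteq> c" "p \<in> {a, b, c, e}" for p
  proof (cases "p \<in> {g, c}")
    case True
    then show ?thesis by (auto simp: hol_def)
  next
    case False
    with assms that show ?thesis by (auto simp: hol_fixes_shifted)
  qed
  then have "shift (x \<star> g) \<star> g = unshift x" if "g \<noteq> c"
    using that by (intro shift_times_generator_aux)
  moreover have "shift (x \<star> c) \<star> c = unshift x"
    by (simp add: shift_def unshift_def)
  ultimately have "shift (x \<star> g) \<star> g = unshift x"
    by metis
  then show ?thesis by (metis cancel)
qed

text \<open>
  The elements \<open>y\<close> whose \<open>R\<^sub>y\<close> inverts \<open>shift\<close> under conjugation form a subkei, since \<open>R\<^sub>y\<^sub>\<star>\<^sub>z\<close> is a
  product of three such maps.
\<close>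

lemma shift_times: "shift (x \<star> y) = unshift x \<star> y"
proof -
  have unshift_times: "unshift (x \<star> y) = shift x \<star> y"
    if "\<And>x. shift (x \<star> y) = unshift x \<star> y" for x y
    using that[of "shift x"] by (metis shift_unshift)
  have "\<forall>x. shift (x \<star> y) = unshift x \<star> y"
  proof (rule generated[of "\<lambda>y. \<forall>x. shift (x \<star> y) = unshift x \<star> y"])
    fix y z
    assume "\<forall>x. shift (x \<star> y) = unshift x \<star> y" "\<forall>x. shift (x \<star> z) = unshift x \<star> z"
    then show "\<forall>x. shift (x \<star> (y \<star> z)) = unshift x \<star> (y \<star> z)"
      by (simp add: star_star unshift_times)
  qed (simp_all add: shift_times_generator)
  then show ?thesis by blast
qed

lemma unshift_times: "unshift (x \<star> y) = shift x \<star> y"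
  using shift_times[of "shift x" y] by (metis shift_unshift)

section \<open>The affine quotient\<close>

text \<open>
  The orbits of \<open>shift\<close>, whose cube is the identity.
\<close>

definition near :: "'a \<Rightarrow> 'a \<Rightarrow> bool"  (infix "\<approx>" 50) where
  "x \<approx> y \<longleftrightarrow> y = x \<or> y = shift x \<or> y = unshift x"

lemma near_refl [simp]: "x \<approx> x"
  by (simp add: near_def)

lemma near_sym: "x \<approx> y \<Longrightarrow> y \<approx> x"
  by (auto simp: near_def)

lemma near_trans [trans]: "x \<approx> y \<Longrightarrow> y \<approx> z \<Longrightarrow> x \<approx> z"
  by (auto simp: near_def)

lemma near_star:
  assumes "x \<approx> x'" "y \<approx> y'"
  shows "x \<star> y \<approx> x' \<star> y'"
proof -
  have times: "u \<star> v \<approx> u' \<star> v" if "u \<approx> u'" for u u' v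
    using that shift_times[of u v] unshift_times[of u v] unfolding near_def by metis
  have "x \<star> y \<approx> x' \<star> y" using assms(1) by (rule times)
  also have "x' \<star> y \<approx> x' \<star> y'" using times[OF assms(2)] by (simp add: comm)
  finally show ?thesis .
qed

text \<open>
  The points that stay in their orbit form a subkei.
\<close>

lemma hol_near:
  assumes "\<And>p. p \<in> {a, b, c, e} \<Longrightarrow> hol x y z p \<approx> p"
  shows "hol x y z p \<approx> p"
  by (rule generated[of "\<lambda>p. hol x y z p \<approx> p"]) (simp_all add: assms hol_star near_star)

lemma hol_near_c: "hol a e b c \<approx> c" "hol b e a c \<approx> c"
proof -
  have "shift c = hol a e b c"
    by (simp add: shift_def shifted_def comm[of c "hol a e b c"])
  moreover have "unshift c = hol b e a c"
    by (simp add: unshift_def shifted_def hol_collinear)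
  ultimately show "hol a e b c \<approx> c" "hol b e a c \<approx> c"
    by (metis near_def near_sym)+
qed

text \<open>
  A holonomy of three generators fixes these three, and it remains to see that it keeps the fourth in
  its orbit.  For the triple \<open>x\<close>, \<open>e\<close>, \<open>c\<close> this is reduced to the displacement of \<open>c\<close> by means of
  \<open>hol_exchange\<close>, as \<open>y\<close> is reached from \<open>d \<star> c\<close> by letters that the holonomy fixes.
\<close>

lemma hol_near_exchange:
  assumes "hol y e x c \<approx> c"
  shows "hol x e c y \<approx> y"
proof -
  define d where "d = y \<star> x \<star> e"
  have y: "y = d \<star> c \<star> c \<star> e \<star> x"
    by (simp add: d_def)
  have "hol x e c y = hol x e c (d \<star> c) \<star> c \<star> e \<star> x"
    by (subst y) (simp only: hol_star_fixed)
  also have "\<dots> = hol y e x c \<star> d \<star> c \<star> e \<star> x"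
    by (simp only: d_def hol_exchange)
  also have "\<dots> \<approx> c \<star> d \<star> c \<star> e \<star> x"
    by (intro near_star assms near_refl)
  also have "c \<star> d \<star> c \<star> e \<star> x = y"
    by (subst y) (simp add: comm[of c d])
  finally show ?thesis .
qed

lemma near_swap:
  assumes "y \<in> {a, b, c}" "z \<in> {a, b, c}"
  shows "x \<star> y \<star> e \<star> z \<approx> x \<star> z \<star> e \<star> y"
proof -
  have step: "x \<star> y \<star> e \<star> z \<approx> x \<star> z \<star> e \<star> y"
    if "\<And>p. p \<in> {a, b, c, e} \<Longrightarrow> hol y e z p \<approx> p" for x y z
  proof -
    have "hol y e z x \<star> z \<star> e \<star> y \<approx> x \<star> z \<star> e \<star> y"
      by (intro near_star near_refl, rule hol_near, rule that)
    then show ?thesis by (simp add: hol_def)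
  qed
  have "hol a e b p \<approx> p" if "p \<in> {a, b, c, e}" for p
    using that hol_near_c(1) by auto
  note ab = step[OF this]
  have "hol a e c p \<approx> p" if "p \<in> {a, b, c, e}" for p
    using that hol_near_exchange[OF hol_near_c(2)] by auto
  note ac = step[OF this]
  have "hol b e c p \<approx> p" if "p \<in> {a, b, c, e}" for p
    using that hol_near_exchange[OF hol_near_c(1)] by auto
  note bc = step[OF this]
  from assms have "y = a \<or> y = b \<or> y = c" "z = a \<or> z = b \<or> z = c"
    by simp_all
  then show ?thesis
    by (elim disjE)
      (simp_all only: ab ac bc ab[THEN near_sym] ac[THEN near_sym] bc[THEN near_sym] near_refl)
qed

definition transl :: "'a \<Rightarrow> 'a \<Rightarrow> 'a" where "transl g x = x \<star> e \<star> g"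

lemma transl_near: "x \<approx> y \<Longrightarrow> transl g x \<approx> transl g y"
  unfolding transl_def by (intro near_star near_refl)

lemma transl_pow_near: "x \<approx> y \<Longrightarrow> (transl g ^^ n) x \<approx> (transl g ^^ n) y"
  by (induction n) (auto intro: transl_near)

lemma transl_commute:
  assumes "g \<in> {a, b, c}" "h \<in> {a, b, c}"
  shows "transl g ((transl h ^^ n) x) \<approx> (transl h ^^ n) (transl g x)"
proof (induction n)
  case (Suc n)
  have "transl g (transl h y) \<approx> transl h (transl g y)" for y
    using assms by (simp add: transl_def near_swap)
  from near_trans[OF this[of "(transl h ^^ n) x"] transl_near[OF Suc.IH]]
  show ?case by simp
qed simp

lemma transl_cubed: "transl g ^^ 3 = id"
  by (simp add: fun_eq_iff eval_nat_numeral transl_def braid[of _ g e])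

lemma transl_pow_mod: "transl g ^^ (n mod 3) = transl g ^^ n"
proof -
  have "transl g ^^ n = (transl g ^^ 3) ^^ (n div 3) \<circ> transl g ^^ (n mod 3)"
    by (metis funpow_add funpow_mult mult_div_mod_eq)
  then show ?thesis by (simp add: transl_cubed)
qed

text \<open>
  Reflection in \<open>e\<close> inverts a translation; the inverse is written as the square.
\<close>

lemma transl_pow_star_e: "(transl g ^^ n) x \<star> e = (transl g ^^ (2 * n)) (x \<star> e)"
proof (induction n)
  case (Suc n)
  have "transl g y \<star> e = transl g (transl g (y \<star> e))" for y
    by (simp add: transl_def braid)
  with Suc.IH show ?case by simp
qed simp

section \<open>At most 81 elements\<close>

definition grid_point :: "nat \<Rightarrow> nat \<Rightarrow> nat \<Rightarrow> 'a" where
  "grid_point i j k = (transl c ^^ k) ((transl b ^^ j) ((transl a ^^ i) e))"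

definition reachable :: "'a \<Rightarrow> bool" where
  "reachable x \<longleftrightarrow> (\<exists>i j k. x \<approx> grid_point i j k)"

lemma reachable_near: "x \<approx> y \<Longrightarrow> reachable y \<Longrightarrow> reachable x"
  unfolding reachable_def by (meson near_trans)

lemma reachable_star_e:
  assumes "reachable x"
  shows "reachable (x \<star> e)"
proof -
  from assms obtain i j k where "x \<approx> grid_point i j k"
    by (auto simp: reachable_def)
  then have "x \<star> e \<approx> grid_point i j k \<star> e"
    by (intro near_star near_refl)
  also have "\<dots> = grid_point (2 * i) (2 * j) (2 * k)"
    by (simp add: grid_point_def transl_pow_star_e)
  finally show ?thesis unfolding reachable_def by blast
qed

lemma reachable_transl:
  assumes "reachable x" "g \<in> {a, b, c}"
  shows "reachable (transl g x)"
proof -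
  from assms obtain i j k where "x \<approx> grid_point i j k"
    by (auto simp: reachable_def)
  then have "transl g x \<approx> transl g (grid_point i j k)"
    by (rule transl_near)
  moreover have "reachable (transl g (grid_point i j k))"
  proof -
    have "transl c (grid_point i j k) = grid_point i j (Suc k)"
      by (simp add: grid_point_def)
    moreover have "transl b (grid_point i j k) \<approx> grid_point i (Suc j) k"
      by (simp add: grid_point_def transl_commute)
    moreover have "transl a (grid_point i j k) \<approx> grid_point (Suc i) j k"
      unfolding grid_point_def funpow.simps o_apply
      by (rule near_trans[OF transl_commute transl_pow_near[OF transl_commute]]) simp_all
    moreover from assms(2) consider "g = a" | "g = b" | "g = c" by blast
    ultimately show ?thesis
      unfolding reachable_def by cases (metis near_refl)+
  qed
  ultimately show ?thesis by (rule reachable_near)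
qed

lemma reachable_star:
  assumes "reachable x"
  shows "reachable (x \<star> y)"
proof -
  have "\<forall>x. reachable x \<longrightarrow> reachable (x \<star> y)"
  proof (rule generated[of "\<lambda>y. \<forall>x. reachable x \<longrightarrow> reachable (x \<star> y)"])
    have "reachable (x \<star> g)" if "reachable x" "g \<in> {a, b, c}" for x g
      using reachable_transl[OF reachable_star_e[OF that(1)] that(2)] by (simp add: transl_def)
    then show "\<forall>x. reachable x \<longrightarrow> reachable (x \<star> a)"
      "\<forall>x. reachable x \<longrightarrow> reachable (x \<star> b)" "\<forall>x. reachable x \<longrightarrow> reachable (x \<star> c)"
      by blast+
  qed (simp_all add: reachable_star_e star_star)
  with assms show ?thesis by simp
qed

lemma all_reachable: "reachable x"
proof -
  have "e = grid_point 0 0 0"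
    by (simp add: grid_point_def)
  then have "reachable e"
    unfolding reachable_def by (metis near_refl)
  then have "reachable (e \<star> (e \<star> x))" by (rule reachable_star)
  then show ?thesis by simp
qed

theorem card_le_81: "finite (UNIV :: 'a set)" "card (UNIV :: 'a set) \<le> 81"
proof -
  define param where "param = (\<lambda>(i, j, k, l). (shift ^^ l) (grid_point i j k))"
  define box :: "(nat \<times> nat \<times> nat \<times> nat) set" where "box = {..<3} \<times> {..<3} \<times> {..<3} \<times> {..<3}"
  have "x \<in> param ` box" for x
  proof -
    from all_reachable[of x] obtain i j k where "grid_point i j k \<approx> x"
      unfolding reachable_def by (blast intro: near_sym)
    moreover have "grid_point i j k = grid_point (i mod 3) (j mod 3) (k mod 3)"
      by (simp add: grid_point_def transl_pow_mod)
    moreover have "\<exists>l<3. z = (shift ^^ l) y" if "y \<approx> z" for y z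
    proof -
      from that have "z = (shift ^^ 0) y \<or> z = (shift ^^ 1) y \<or> z = (shift ^^ 2) y"
        by (simp add: near_def eval_nat_numeral)
      then show ?thesis by (elim disjE) (rule exI, rule conjI[rotated], assumption, simp)+
    qed
    ultimately obtain l where "l < 3" "x = (shift ^^ l) (grid_point (i mod 3) (j mod 3) (k mod 3))"
      by metis
    then have "x = param (i mod 3, j mod 3, k mod 3, l)" "(i mod 3, j mod 3, k mod 3, l) \<in> box"
      by (simp_all add: param_def box_def)
    then show ?thesis by blast
  qed
  then have univ: "UNIV = param ` box" by blast
  have box: "finite box" "card box = 81"
    by (simp_all add: box_def card_cartesian_product)
  show "finite (UNIV :: 'a set)"
    unfolding univ using box(1) by (rule finite_imageI)
  show "card (UNIV :: 'a set) \<le> 81"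
    unfolding univ using card_image_le[OF box(1), of param] box(2) by simp
qed

end

section \<open>A commutative kei with 81 elements\<close>

type_synonym quad = "3 \<times> 3 \<times> 3 \<times> 3"

text \<open>
  The Hall triple system of order 81, the smallest one that is not an affine space.  Both factors of
  the cubic term are antisymmetric in the two points, which makes the product commutative; that the
  operation is distributive depends on the characteristic being 3.
\<close>

fun hall :: "quad \<Rightarrow> quad \<Rightarrow> quad" where
  "hall (x, y, z, t) (x', y', z', t') =
    (- x - x', - y - y', - z - z', - t - t' + (z - z') * (x * y' - y * x'))"

lemma hall_kei: "kei UNIV hall"
proof
  have "(3 :: 3) = 0" by simp
  then have three: "u * 3 = 0" for u :: 3
    by (simp only: mult_zero_right)
  have double: "- u - u = u" for u :: 3
    using three[of u] by (simp add: algebra_simps eq_neg_iff_add_eq_0)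
  fix a b c :: quad
  show "hall (hall a b) c = hall (hall a c) (hall b c)"
    by (cases a; cases b; cases c) (simp add: algebra_simps three)
  show "hall (hall a b) b = a"
    by (cases a; cases b) (simp add: algebra_simps three)
  show "hall a a = a"
    by (cases a) (simp add: double)
qed simp_all

lemma hall_satisfies_r: "satisfies_r 3 UNIV hall"
proof -
  have "hall b a = hall a b" for a b
    by (cases a; cases b) (simp add: algebra_simps)
  then show ?thesis
    unfolding satisfies_r_def alt_prod_3 by (metis UNIV_I kei.invol[OF hall_kei])
qed

lemma residue_cases: "u \<in> {0, 1, - 1}" for u :: 3
proof -
  have "card {0, 1, - 1 :: 3} = CARD(3)" by simp
  then have "{0, 1, - 1 :: 3} = UNIV" by (intro card_subset_eq) auto
  then show ?thesis by simp
qed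

lemma hall_generated:
  assumes gens: "(0, 0, 0, 0) \<in> S" "(1, 0, 0, 0) \<in> S" "(0, 1, 0, 0) \<in> S" "(0, 0, 1, 0) \<in> S"
    and closed: "\<And>v w. v \<in> S \<Longrightarrow> w \<in> S \<Longrightarrow> hall v w \<in> S"
  shows "S = UNIV"
proof -
  have neg: "(- x, - y, - z, - t) \<in> S" if "(x, y, z, t) \<in> S" for x y z t
    using closed[OF that gens(1)] by simp
  have axis1: "(x, 0, 0, 0) \<in> S" for x
    using residue_cases[of x] gens neg[OF gens(2)] by auto
  have axis2: "(0, y, 0, 0) \<in> S" for y
    using residue_cases[of y] gens neg[OF gens(3)] by auto
  have axis3: "(0, 0, z, 0) \<in> S" for z
    using residue_cases[of z] gens neg[OF gens(4)] by auto
  have plane: "(x, y, 0, 0) \<in> S" for x y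
    using closed[OF axis1[of "- x"] axis2[of "- y"]] by simp
  have space: "(x, y, z, 0) \<in> S" for x y z
    using closed[OF plane[of "- x" "- y"] axis3[of "- z"]] by simp
  \<comment> \<open>The cubic term is 1 for the inner pair of points and 0 for the outer one.\<close>
  have "(0, 0, 0, - 1) \<in> S"
    using closed[OF closed[OF space[of 1 0 1] space[of 0 1 0]] space[of 1 1 1]] by simp
  then have axis4: "(0, 0, 0, t) \<in> S" for t
    using residue_cases[of t] gens neg[of 0 0 0 "- 1"] by auto
  have "(x, y, z, t) \<in> S" for x y z t
    using closed[OF space[of "- x" "- y" "- z"] axis4[of "- t"]] by simp
  then show ?thesis by auto
qed

lemma burnside_kei_onto_hall: "\<exists>h. h ` burnside_kei 4 3 = (UNIV :: quad set)"
proof -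
  define g :: "nat \<Rightarrow> quad" where
    "g i = ([(0, 0, 0, 0), (1, 0, 0, 0), (0, 1, 0, 0), (0, 0, 1, 0)] ! i)" for i
  obtain h where hom: "\<And>A B. A \<in> burnside_kei 4 3 \<Longrightarrow> B \<in> burnside_kei 4 3 \<Longrightarrow>
      h (burnside_op 4 3 A B) = hall (h A) (h B)"
    and gen: "\<And>i. i < 4 \<Longrightarrow> h (burnside_gen 4 3 i) = g i"
    using burnside_kei_universal[OF hall_kei hall_satisfies_r, of 4 g] by blast
  have "g i \<in> h ` burnside_kei 4 3" if "i < 4" for i
    using gen[OF that] burnside_gen_in[OF that] by (metis imageI)
  from this[of 0] this[of 1] this[of 2] this[of 3]
  have "h ` burnside_kei 4 3 = UNIV"
  proof (intro hall_generated)
    fix v w assume "v \<in> h ` burnside_kei 4 3" "w \<in> h ` burnside_kei 4 3"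
    then show "hall v w \<in> h ` burnside_kei 4 3"
      by (auto simp flip: hom intro!: imageI kei.closed[OF burnside_kei_kei])
  qed (simp_all add: g_def eval_nat_numeral)
  then show ?thesis by blast
qed

section \<open>The free commutative kei on four generators\<close>

text \<open>
  The carrier is made a type, so that the upper bound, which is about operations on a whole type,
  applies.
\<close>

typedef burnside_4_3 = "burnside_kei 4 3"
  using burnside_gen_in[of 0 4] by auto

definition star_4_3 :: "burnside_4_3 \<Rightarrow> burnside_4_3 \<Rightarrow> burnside_4_3" where
  "star_4_3 x y = Abs_burnside_4_3 (burnside_op 4 3 (Rep_burnside_4_3 x) (Rep_burnside_4_3 y))"

definition gen_4_3 :: "nat \<Rightarrow> burnside_4_3" where
  "gen_4_3 i = Abs_burnside_4_3 (burnside_gen 4 3 i)"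

lemma Rep_star_4_3:
  "Rep_burnside_4_3 (star_4_3 x y) = burnside_op 4 3 (Rep_burnside_4_3 x) (Rep_burnside_4_3 y)"
  unfolding star_4_3_def
  by (intro Abs_burnside_4_3_inverse kei.closed[OF burnside_kei_kei] Rep_burnside_4_3)

lemma burnside_4_3_induct:
  assumes gens: "\<And>i. i < 4 \<Longrightarrow> P (gen_4_3 i)"
    and star: "\<And>x y. P x \<Longrightarrow> P y \<Longrightarrow> P (star_4_3 x y)"
  shows "P x"
proof -
  have "P (Abs_burnside_4_3 (burnside_class 4 3 s))" if "s \<in> kterms 4" for s
    using that
  proof induction
    case (gen i)
    then show ?case
      using gens by (simp add: gen_4_3_def burnside_gen_def)
  next
    case (op s t)
    then have "star_4_3 (Abs_burnside_4_3 (burnside_class 4 3 s)) (Abs_burnside_4_3 (burnside_class 4 3 t))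
      = Abs_burnside_4_3 (burnside_class 4 3 (Op s t))"
      by (simp add: star_4_3_def Abs_burnside_4_3_inverse burnside_class_in burnside_op_class)
    with star[OF op.IH] show ?case by simp
  qed
  then show ?thesis
    by (cases x) (metis burnside_kei_cases)
qed

interpretation four_generated_commutative_kei
  star_4_3 "gen_4_3 0" "gen_4_3 1" "gen_4_3 2" "gen_4_3 3"
proof unfold_locales
  note K = burnside_kei_kei[of 4 3]
  have r: "burnside_op 4 3 (burnside_op 4 3 B A) B = A"
    if "A \<in> burnside_kei 4 3" "B \<in> burnside_kei 4 3" for A B
    using burnside_kei_satisfies_r[of 3 4] that by (simp add: satisfies_r_def alt_prod_3)
  fix x y z :: burnside_4_3
  let ?x = "Rep_burnside_4_3 x" and ?y = "Rep_burnside_4_3 y"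
  show "star_4_3 x x = x"
    by (simp add: Rep_star_4_3 kei.idem[OF K] Rep_burnside_4_3 flip: Rep_burnside_4_3_inject)
  show "star_4_3 (star_4_3 x y) y = x"
    by (simp add: Rep_star_4_3 kei.invol[OF K] Rep_burnside_4_3 flip: Rep_burnside_4_3_inject)
  show "star_4_3 (star_4_3 x y) z = star_4_3 (star_4_3 x z) (star_4_3 y z)"
    unfolding Rep_burnside_4_3_inject[symmetric] Rep_star_4_3
    by (intro kei.distrib[OF K] Rep_burnside_4_3)
  have "burnside_op 4 3 ?x ?y = burnside_op 4 3 (burnside_op 4 3 (burnside_op 4 3 ?y ?x) ?y) ?y"
    by (simp add: r Rep_burnside_4_3)
  also have "\<dots> = burnside_op 4 3 ?y ?x"
    by (simp add: kei.invol[OF K] kei.closed[OF K] Rep_burnside_4_3)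
  finally show "star_4_3 x y = star_4_3 y x"
    by (simp add: Rep_star_4_3 flip: Rep_burnside_4_3_inject)
next
  fix P x
  assume "P (gen_4_3 0)" "P (gen_4_3 1)" "P (gen_4_3 2)" "P (gen_4_3 3)"
    and "\<And>x y. P x \<Longrightarrow> P y \<Longrightarrow> P (star_4_3 x y)"
  moreover from this have "P (gen_4_3 i)" if "i < 4" for i
    using that by (auto simp: less_Suc_eq eval_nat_numeral)
  ultimately show "P x" by (metis burnside_4_3_induct)
qed simp

theorem theorem6: "card (burnside_kei 4 3) = 81"
proof (rule antisym)
  have range: "range Rep_burnside_4_3 = burnside_kei 4 3"
    using type_definition.Rep_range[OF type_definition_burnside_4_3] .
  show "card (burnside_kei 4 3) \<le> 81"
    using card_image_le[OF card_le_81(1), of Rep_burnside_4_3] card_le_81(2) by (simp add: range)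
  have "finite (burnside_kei 4 3)"
    using finite_imageI[OF card_le_81(1), of Rep_burnside_4_3] by (simp add: range)
  moreover obtain h where "h ` burnside_kei 4 3 = (UNIV :: quad set)"
    using burnside_kei_onto_hall by blast
  ultimately have "card (UNIV :: quad set) \<le> card (burnside_kei 4 3)"
    by (metis card_image_le)
  then show "81 \<le> card (burnside_kei 4 3)" by simp
qed

end
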